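(* Let $T$ be a finite tree with $m$ edges and let $x,y\in V(T)$. Then $$d(x,y)^2 \le H_{xy} \le d(x,y)\,(2m-d(x,y)).$$ The lower bound holds with equality if and only if for every vertex $w\in V(T)$, either $w$ lies on the path from $x$ to $y$ or $y$ lies on the path from $w$ to $x$. The upper bound holds with equality if and only if for every vertex $w\in V(T)$, either $w$ lies on the path from $x$ to $y$ or $x$ lies on the path from $w$ to $y$.
   Context: The simple random walk moves at each step to a uniformly random neighbour; $H_{xy}$ is the expected number of steps for the walk started at $x$ to first reach $y$ ($H_{xx}=0$). $d(x,y)$ is the graph distance. *)

theory Defs
  imports "HOL-Probability.Probability"
begin

section \<open>Finite trees\<close>

text \<open>A simple graph is given by its vertex set \<open>V\<close> and its set \<open>E\<close> of two-element
  edges. A walk or path is the list of its vertices, so its length is one less than the length of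
  the list.\<close>

definition simple_graph :: "'a set \<Rightarrow> 'a set set \<Rightarrow> bool" where
  "simple_graph V E \<longleftrightarrow> finite V \<and> (\<forall>e\<in>E. e \<subseteq> V \<and> card e = 2)"

definition graph_walk :: "'a set \<Rightarrow> 'a set set \<Rightarrow> 'a \<Rightarrow> 'a list \<Rightarrow> 'a \<Rightarrow> bool" where
  "graph_walk V E u p v \<longleftrightarrow>
     p \<noteq> [] \<and> hd p = u \<and> last p = v \<and> set p \<subseteq> V \<and> successively (\<lambda>a b. {a, b} \<in> E) p"

definition graph_path :: "'a set \<Rightarrow> 'a set set \<Rightarrow> 'a \<Rightarrow> 'a list \<Rightarrow> 'a \<Rightarrow> bool" where
  "graph_path V E u p v \<longleftrightarrow> graph_walk V E u p v \<and> distinct p"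

definition graph_cycle :: "'a set \<Rightarrow> 'a set set \<Rightarrow> 'a list \<Rightarrow> bool" where
  "graph_cycle V E p \<longleftrightarrow>
     3 \<le> length p \<and> graph_path V E (hd p) p (last p) \<and> {last p, hd p} \<in> E"

definition graph_connected :: "'a set \<Rightarrow> 'a set set \<Rightarrow> bool" where
  "graph_connected V E \<longleftrightarrow> V \<noteq> {} \<and> (\<forall>u\<in>V. \<forall>v\<in>V. \<exists>p. graph_walk V E u p v)"

definition finite_tree :: "'a set \<Rightarrow> 'a set set \<Rightarrow> bool" where
  "finite_tree V E \<longleftrightarrow>
     simple_graph V E \<and> graph_connected V E \<and> (\<nexists>p. graph_cycle V E p)"

definition graph_dist :: "'a set \<Rightarrow> 'a set set \<Rightarrow> 'a \<Rightarrow> 'a \<Rightarrow> nat" where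
  "graph_dist V E u v = (LEAST n. \<exists>p. graph_walk V E u p v \<and> length p = Suc n)"

text \<open>Only meaningful in a tree, where the path between two vertices is unique.\<close>

definition tree_path :: "'a set \<Rightarrow> 'a set set \<Rightarrow> 'a \<Rightarrow> 'a \<Rightarrow> 'a list" where
  "tree_path V E u v = (THE p. graph_path V E u p v)"


section \<open>Simple random walk\<close>

definition neighbours :: "'a set set \<Rightarrow> 'a \<Rightarrow> 'a set" where
  "neighbours E v = {w. {v, w} \<in> E}"

text \<open>A vertex without neighbours occurs in a tree only if it is the single vertex; there the walk
  stays put.\<close>

definition srw_step :: "'a set set \<Rightarrow> 'a \<Rightarrow> 'a pmf" where
  "srw_step E v = (if neighbours E v = {} then return_pmf v else pmf_of_set (neighbours E v))"

text \<open>The conditional law of the position at time \<open>n\<close> given the positions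
  \<open>\<omega> 0, \<dots>, \<omega> (n - 1)\<close>, for the walk started at \<open>x\<close>.\<close>

definition srw_kernel :: "'a set set \<Rightarrow> 'a \<Rightarrow> nat \<Rightarrow> (nat \<Rightarrow> 'a) \<Rightarrow> 'a measure" where
  "srw_kernel E x n \<omega> =
     measure_pmf (case n of 0 \<Rightarrow> return_pmf x | Suc k \<Rightarrow> srw_step E (\<omega> k))"

text \<open>The law, on infinite trajectories, of the simple random walk started at \<open>x\<close>: the measure that
  the Ionescu-Tulcea theorem attaches to the kernels above. Its finite-dimensional distributions
  are computed in \<open>emeasure_srw_cylinder\<close>.\<close>

definition srw :: "'a set set \<Rightarrow> 'a \<Rightarrow> (nat \<Rightarrow> 'a) measure" where
  "srw E x = projective_family.lim UNIV
     (Ionescu_Tulcea.CI (srw_kernel E x) (\<lambda>_. count_space UNIV)) (\<lambda>_. count_space UNIV)"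

definition first_hit :: "'a \<Rightarrow> (nat \<Rightarrow> 'a) \<Rightarrow> enat" where
  "first_hit y \<omega> = (INF n\<in>{n. \<omega> n = y}. enat n)"

text \<open>The value \<open>\<infinity>\<close> is allowed for \<open>first_hit\<close> and for its expectation. The result is an \<open>ereal\<close>
  rather than an \<open>ennreal\<close>, so that it can be compared with differences without truncation.\<close>

definition hitting_time :: "'a set set \<Rightarrow> 'a \<Rightarrow> 'a \<Rightarrow> ereal" where
  "hitting_time E x y = enn2ereal (\<integral>\<^sup>+ \<omega>. ennreal_of_enat (first_hit y \<omega>) \<partial>srw E x)"


lemma Ionescu_Tulcea_srw: "Ionescu_Tulcea (srw_kernel E x) (\<lambda>_. count_space UNIV)"
proof (rule Ionescu_Tulcea.intro)
  fix i
  show "srw_kernel E x i \<in> measurable (PiM {0..<i} (\<lambda>_. count_space UNIV)) (subprob_algebra (count_space UNIV))"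
  proof (cases i)
    case 0
    then show ?thesis
      by (auto simp: srw_kernel_def[abs_def] space_subprob_algebra measure_pmf.subprob_space_axioms)
  next
    case (Suc k)
    have "(\<lambda>\<omega>. measure_pmf (srw_step E (\<omega> k)))
        \<in> measurable (PiM {0..<i} (\<lambda>_. count_space UNIV)) (subprob_algebra (count_space UNIV))"
    proof (rule measurable_compose[where f = "\<lambda>\<omega>. \<omega> k" and N = "count_space UNIV"])
      show "(\<lambda>\<omega>. \<omega> k) \<in> measurable (PiM {0..<i} (\<lambda>_. count_space UNIV)) (count_space UNIV)"
        using Suc by (intro measurable_component_singleton) auto
    qed (auto simp: space_subprob_algebra measure_pmf.subprob_space_axioms)
    then show ?thesis using Suc by (simp add: srw_kernel_def[abs_def])
  qed
next
  fix i \<omega>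
  show "prob_space (srw_kernel E x i \<omega>)"
    unfolding srw_kernel_def by (rule measure_pmf.prob_space_axioms)
qed

context
  fixes E :: "'a set set" and x :: 'a
begin

interpretation srw: Ionescu_Tulcea "srw_kernel E x" "\<lambda>_. count_space UNIV"
  by (rule Ionescu_Tulcea_srw)

lemma sets_srw: "sets (srw E x) = sets (PiM UNIV (\<lambda>_. count_space UNIV))"
  by (simp add: srw_def)

lemma space_srw: "space (srw E x) = UNIV"
  using sets_eq_imp_space_eq[OF sets_srw] by (simp add: space_PiM PiE_def)

lemma srw_coordinate_measurable: "(\<lambda>\<omega>. \<omega> n) \<in> measurable (srw E x) (count_space UNIV)"
  by (subst measurable_cong_sets[OF sets_srw refl]) (rule measurable_component_singleton, simp)

lemma first_hit_measurable: "first_hit y \<in> measurable (srw E x) (count_space UNIV)"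
proof -
  have [measurable]: "Measurable.pred (srw E x) (\<lambda>\<omega>. \<omega> n = y)" for n
    using srw_coordinate_measurable[of n] by (rule pred_count_space_const1)
  have eq: "first_hit y = (\<lambda>\<omega>. INF n. if \<omega> n = y then enat n else \<infinity>)"
  proof (intro ext antisym)
    fix \<omega> :: "nat \<Rightarrow> 'a"
    show "first_hit y \<omega> \<le> (INF n. if \<omega> n = y then enat n else \<infinity>)"
      unfolding first_hit_def by (rule INF_greatest) (auto intro: INF_lower)
    show "(INF n. if \<omega> n = y then enat n else \<infinity>) \<le> first_hit y \<omega>"
      unfolding first_hit_def
    proof (rule INF_greatest)
      fix n assume "n \<in> {n. \<omega> n = y}"
      then show "(INF n. if \<omega> n = y then enat n else \<infinity>) \<le> enat n"
        by (intro INF_lower2[of n]) auto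
    qed
  qed
  show ?thesis unfolding eq by measurable
qed

lemma sets_cylinder:
  fixes n :: nat and v :: "nat \<Rightarrow> 'a"
  assumes "{..n} \<subseteq> I"
  shows "{\<omega> \<in> space (PiM I (\<lambda>_. count_space UNIV)). \<forall>i\<le>n. \<omega> i = v i}
     \<in> sets (PiM I (\<lambda>_. count_space UNIV))"
proof -
  have "{\<omega> \<in> space (PiM I (\<lambda>_. count_space UNIV)). \<forall>i\<in>{..n}. \<omega> i = v i}
     \<in> sets (PiM I (\<lambda>_. count_space UNIV))"
  proof (rule sets.sets_Collect_finite_All)
    fix i assume "i \<in> {..n}"
    then have "(\<lambda>\<omega>. \<omega> i) \<in> measurable (PiM I (\<lambda>_. count_space UNIV)) (count_space UNIV)"
      using assms by (intro measurable_component_singleton) auto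
    then have "(\<lambda>\<omega>. \<omega> i) -` {v i} \<inter> space (PiM I (\<lambda>_. count_space UNIV))
       \<in> sets (PiM I (\<lambda>_. count_space UNIV))"
      by (rule measurable_sets) simp
    moreover have "(\<lambda>\<omega>. \<omega> i) -` {v i} \<inter> space (PiM I (\<lambda>_. count_space UNIV))
        = {\<omega> \<in> space (PiM I (\<lambda>_. count_space UNIV)). \<omega> i = v i}"
      by blast
    ultimately show "{\<omega> \<in> space (PiM I (\<lambda>_. count_space UNIV)). \<omega> i = v i}
       \<in> sets (PiM I (\<lambda>_. count_space UNIV))"
      by (simp only:)
  qed simp
  then show ?thesis by (simp only: Ball_def atMost_iff)
qed

lemma emeasure_srw_C:
  "emeasure (srw.C 0 (Suc n) (\<lambda>_. undefined))
     {\<omega> \<in> space (PiM {0..<Suc n} (\<lambda>_. count_space UNIV)). \<forall>i\<le>n. \<omega> i = v i}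
   = indicator {x} (v 0) * (\<Prod>i<n. ennreal (pmf (srw_step E (v i)) (v (Suc i))))"
proof (induction n)
  case 0
  let ?M = "\<lambda>k. PiM {0..<k} (\<lambda>_::nat. count_space (UNIV::'a set))"
  let ?A = "{\<omega> \<in> space (?M (Suc 0)). \<forall>i\<le>0. \<omega> i = v i}"
  have u: "(\<lambda>_. undefined) \<in> space (?M 0)" by (simp add: space_PiM)
  have A: "?A \<in> sets (?M (Suc 0))" by (rule sets_cylinder) auto
  have "emeasure (srw.C 0 (Suc 0) (\<lambda>_. undefined)) ?A
      = emeasure (srw.eP 0 (\<lambda>_. undefined)) ?A"
    using u bind_return[OF srw.measurable_eP[of 0] u] by simp
  also have "\<dots> = emeasure (srw_kernel E x 0 (\<lambda>_. undefined)) {v 0}"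
    using srw.emeasure_eP[OF u A]
    by (simp add: vimage_def space_PiM PiE_def extensional_def cong: conj_cong)
  also have "\<dots> = indicator {x} (v 0)"
    by (simp add: srw_kernel_def indicator_def)
  finally show ?case by simp
next
  case (Suc n)
  let ?M = "\<lambda>k. PiM {0..<k} (\<lambda>_::nat. count_space (UNIV::'a set))"
  let ?A = "\<lambda>k. {\<omega> \<in> space (?M (Suc k)). \<forall>i\<le>k. \<omega> i = v i}"
  let ?p = "ennreal (pmf (srw_step E (v n)) (v (Suc n)))"
  let ?C = "srw.C 0 (Suc n) (\<lambda>_. undefined)"
  have u: "(\<lambda>_. undefined) \<in> space (?M 0)" by (simp add: space_PiM)
  have A: "?A k \<in> sets (?M (Suc k))" for k by (rule sets_cylinder) auto
  have sp: "space ?C = space (?M (Suc n))" using srw.space_C[OF u, of "Suc n"] by simp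
  have st: "sets ?C = sets (?M (Suc n))" using srw.sets_C[OF u, of "Suc n"] by simp
  have eP: "emeasure (srw.eP (Suc n) \<omega>) (?A (Suc n)) = ?p * indicator (?A n) \<omega>"
    if \<omega>: "\<omega> \<in> space (?M (Suc n))" for \<omega>
  proof -
    have *: "fun_upd \<omega> (Suc n) -` ?A (Suc n) \<inter> space (count_space UNIV)
        = (if \<omega> \<in> ?A n then {v (Suc n)} else {})"
      using \<omega> by (auto simp: space_PiM PiE_def extensional_def le_Suc_eq)
    have "emeasure (srw.eP (Suc n) \<omega>) (?A (Suc n))
        = emeasure (measure_pmf (srw_step E (\<omega> n))) (if \<omega> \<in> ?A n then {v (Suc n)} else {})"
      unfolding srw.emeasure_eP[OF \<omega> A[of "Suc n"]] * by (simp only: srw_kernel_def nat.case)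
    also have "\<dots> = ?p * indicator (?A n) \<omega>"
    proof (cases "\<omega> \<in> ?A n")
      case True
      then have "\<omega> n = v n" by blast
      with True show ?thesis
        by (simp only: if_True emeasure_pmf_single indicator_simps mult_1_right)
    next
      case False
      then show ?thesis
        by (simp only: if_False emeasure_empty indicator_def of_bool_eq mult_zero_right)
    qed
    finally show ?thesis .
  qed
  have "emeasure (srw.C 0 (Suc (Suc n)) (\<lambda>_. undefined)) (?A (Suc n))
      = emeasure (?C \<bind> srw.eP (Suc n)) (?A (Suc n))"
    by simp
  also have "\<dots> = (\<integral>\<^sup>+ \<omega>. emeasure (srw.eP (Suc n) \<omega>) (?A (Suc n)) \<partial>?C)"
  proof (rule emeasure_bind[OF _ _ A])
    show "space ?C \<noteq> {}" unfolding sp by (simp add: space_PiM PiE_eq_empty_iff)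
    show "srw.eP (Suc n) \<in> measurable ?C (subprob_algebra (?M (Suc (Suc n))))"
      unfolding measurable_cong_sets[OF st refl] by (rule srw.measurable_eP)
  qed
  also have "\<dots> = (\<integral>\<^sup>+ \<omega>. ?p * indicator (?A n) \<omega> \<partial>?C)"
    by (rule nn_integral_cong, rule eP) (simp only: sp)
  also have "\<dots> = ?p * emeasure ?C (?A n)"
    by (rule nn_integral_cmult_indicator) (simp only: st A)
  finally show ?case
    unfolding Suc.IH by (simp add: mult_ac)
qed

lemma emeasure_srw_cylinder:
  "emeasure (srw E x) {\<omega>. \<forall>i\<le>n. \<omega> i = v i}
   = indicator {x} (v 0) * (\<Prod>i<n. ennreal (pmf (srw_step E (v i)) (v (Suc i))))"
proof -
  let ?M = "PiM {0..<Suc n} (\<lambda>_::nat. count_space (UNIV::'a set))"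
  let ?A = "{\<omega> \<in> space ?M. \<forall>i\<le>n. \<omega> i = v i}"
  have A: "?A \<in> sets ?M" by (rule sets_cylinder) auto
  have "prod_emb UNIV (\<lambda>_. count_space UNIV) {0..<Suc n} ?A = {\<omega>. \<forall>i\<le>n. \<omega> i = v i}"
    by (auto simp: prod_emb_def space_PiM PiE_def)
  then have "emeasure (srw E x) {\<omega>. \<forall>i\<le>n. \<omega> i = v i} = emeasure (srw.CI {0..<Suc n}) ?A"
    unfolding srw_def using srw.lim[OF _ A] by simp
  also have "\<dots> = emeasure (srw.C 0 (Suc n) (\<lambda>_. undefined)) ?A"
  proof -
    have "prod_emb {0..<Suc n} (\<lambda>_. count_space UNIV) {0..<Suc n} ?A = ?A"
      by (rule prod_emb_id) (auto simp: space_PiM)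
    then show ?thesis using srw.emeasure_CI[OF subset_refl A] by simp
  qed
  finally show ?thesis unfolding emeasure_srw_C .
qed

lemma prob_space_srw: "prob_space (srw E x)"
proof -
  have "emeasure (srw E x) (prod_emb UNIV (\<lambda>_. count_space UNIV) {} (space (PiM {} (\<lambda>_. count_space UNIV))))
      = emeasure (srw.CI {}) (space (PiM {} (\<lambda>_. count_space UNIV)))"
    unfolding srw_def by (rule srw.lim) auto
  also have "\<dots> = 1"
    using prob_space.emeasure_space_1[OF srw.PF.prob_space_P[of "{}"]]
    by (simp add: srw.CI_def)
  finally show ?thesis
    by (intro prob_spaceI) (simp add: space_srw prod_emb_def space_PiM vimage_def restrict_def)
qed

end

end

theory Submission
  imports Defs
begin

text \<open>
  Write \<open>l(w) = (d(x,y) + d(w,y) - d(x,w)) / 2\<close> for the length of the common part of the paths from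
  \<open>x\<close> and from \<open>w\<close> to \<open>y\<close>. A vertex \<open>v \<noteq> w\<close> has exactly one neighbour closer to \<open>w\<close>, all others being
  farther by one, so the graph Laplacian of \<open>d(\<cdot>,w)\<close> is explicit, and \<open>H(x,y) = \<Sum>\<^sub>w deg(w) l(w)\<close> solves
  the one-step equations of the hitting time; a bounded non-negative solution is unique.
  Rewriting this as a sum of \<open>l(a) + l(b)\<close> over the edges \<open>{a,b}\<close>, the edges of the path from \<open>x\<close> to \<open>y\<close>
  contribute \<open>1 + 3 + \<dots> + (2d - 1) = d\<^sup>2\<close>. On each of the \<open>m - d\<close> other edges \<open>l\<close> is constant with
  a value between \<open>0\<close> and \<open>d\<close>, so the sum lies between \<open>d\<^sup>2\<close> and \<open>d\<^sup>2 + 2d(m - d) = d(2m - d)\<close>, and the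
  extremes are reached exactly when \<open>l = 0\<close>, respectively \<open>l = d\<close>, at all vertices off the path.
\<close>

subsection \<open>Hitting times from the one-step equations\<close>

text \<open>A single measurability fact for all events below: \<open>P\<close> trivially true gives
  staying in \<open>W\<close>, and \<open>m\<close> equal to \<open>n\<close> or
  \<open>Suc n\<close> fixes the current or the next position.\<close>

lemma sets_srw_Ball:
  "{\<omega>. (\<forall>i\<le>n. \<omega> i \<in> W) \<and> P (\<omega> m)} \<in> sets (srw E x)"
proof -
  have pred: "Measurable.pred (srw E x) (\<lambda>\<omega>. Q (\<omega> k))" for Q k
    by (rule measurable_compose[OF srw_coordinate_measurable]) simp
  have "Measurable.pred (srw E x) (\<lambda>\<omega>. (\<forall>i\<in>{..n}. \<omega> i \<in> W) \<and> P (\<omega> m))"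
    by (intro pred_intros_logic pred_intros_finite pred finite_atMost)
  then show ?thesis by (simp add: pred_def space_srw Ball_def)
qed

text \<open>Only cylinder probabilities are known. As \<open>W\<close> is finite, the event is a
  finite disjoint union of cylinders, one for each trajectory in \<open>W\<close> ending at
  \<open>v\<close>, and one more step multiplies each probability by the same factor.\<close>

lemma srw_markov:
  assumes "finite W"
  shows "measure (srw E x) {\<omega>. (\<forall>i\<le>n. \<omega> i \<in> W) \<and> \<omega> n = v \<and> \<omega> (Suc n) = u}
    = measure (srw E x) {\<omega>. (\<forall>i\<le>n. \<omega> i \<in> W) \<and> \<omega> n = v} * pmf (srw_step E v) u"
proof -
  interpret prob_space "srw E x" by (rule prob_space_srw)
  \<comment> \<open>Trajectories are extensional on \<open>{..n}\<close>, so distinct ones differ at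
    some time up to \<open>n\<close> and their cylinders are disjoint.\<close>
  define F where "F = {f \<in> PiE {..n} (\<lambda>_. W). f n = v}"
  define cyl where "cyl k f = {\<omega>. \<forall>i\<le>k. \<omega> i = f i}" for k :: nat and f :: "nat \<Rightarrow> 'a"
  have fin: "finite F"
    unfolding F_def using assms by (intro finite_subset[OF _ finite_PiE[of "{..n}" "\<lambda>_. W"]]) auto
  have cyl_sets: "cyl k f \<in> events" for k f
    using sets_cylinder[of k UNIV f] by (simp add: cyl_def sets_srw space_PiM PiE_def)
  have restr: "restrict \<omega> {..n} \<in> F" if "\<forall>i\<le>n. \<omega> i \<in> W" "\<omega> n = v" for \<omega>
    using that by (auto simp: F_def)
  have disj: "disjoint_family_on (cyl n) F"
  proof (unfold disjoint_family_on_def, intro ballI impI)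
    fix f g assume fg: "f \<in> F" "g \<in> F" "f \<noteq> g"
    have "f = g" if "\<omega> \<in> cyl n f" "\<omega> \<in> cyl n g" for \<omega>
    proof (rule PiE_ext[of f "{..n}" "\<lambda>_. W" g])
      show "f i = g i" if "i \<in> {..n}" for i
        using that \<open>\<omega> \<in> cyl n f\<close> \<open>\<omega> \<in> cyl n g\<close> by (auto simp: cyl_def)
    qed (use fg in \<open>auto simp: F_def\<close>)
    with fg(3) show "cyl n f \<inter> cyl n g = {}" by blast
  qed
  have sub: "cyl (Suc n) (f(Suc n := u)) \<subseteq> cyl n f" for f
    by (auto simp: cyl_def)
  have disj': "disjoint_family_on (\<lambda>f. cyl (Suc n) (f(Suc n := u))) F"
    using disj sub unfolding disjoint_family_on_def by blast
  have step: "prob (cyl (Suc n) (f(Suc n := u))) = prob (cyl n f) * pmf (srw_step E v) u"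
    if "f \<in> F" for f
  proof -
    have "emeasure (srw E x) (cyl (Suc n) (f(Suc n := u)))
        = emeasure (srw E x) (cyl n f) * ennreal (pmf (srw_step E v) u)"
      using that unfolding cyl_def emeasure_srw_cylinder
      by (simp add: F_def mult_ac)
    then show ?thesis
      by (simp add: measure_def enn2real_mult)
  qed
  have "{\<omega>. (\<forall>i\<le>n. \<omega> i \<in> W) \<and> \<omega> n = v \<and> \<omega> (Suc n) = u}
      = (\<Union>f\<in>F. cyl (Suc n) (f(Suc n := u)))" (is "?L = ?R")
  proof
    show "?L \<subseteq> ?R"
    proof
      fix \<omega> assume w: "\<omega> \<in> ?L"
      then have "\<omega> \<in> cyl (Suc n) ((restrict \<omega> {..n})(Suc n := u))"
        by (auto simp: cyl_def le_Suc_eq)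
      moreover have "restrict \<omega> {..n} \<in> F" using w by (intro restr) auto
      ultimately show "\<omega> \<in> ?R" by blast
    qed
  qed (auto simp: cyl_def F_def PiE_iff le_Suc_eq)
  then have "prob {\<omega>. (\<forall>i\<le>n. \<omega> i \<in> W) \<and> \<omega> n = v \<and> \<omega> (Suc n) = u}
      = (\<Sum>f\<in>F. prob (cyl (Suc n) (f(Suc n := u))))"
    using finite_measure_finite_Union[OF fin _ disj'] cyl_sets by auto
  also have "\<dots> = (\<Sum>f\<in>F. prob (cyl n f)) * pmf (srw_step E v) u"
    by (simp add: step sum_distrib_right)
  also have "(\<Sum>f\<in>F. prob (cyl n f)) = prob (\<Union>f\<in>F. cyl n f)"
    by (rule finite_measure_finite_Union[OF fin _ disj, symmetric]) (use cyl_sets in auto)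
  also have "(\<Union>f\<in>F. cyl n f) = {\<omega>. (\<forall>i\<le>n. \<omega> i \<in> W) \<and> \<omega> n = v}" (is "?L = ?R")
  proof
    show "?R \<subseteq> ?L"
    proof
      fix \<omega> assume w: "\<omega> \<in> ?R"
      then have "\<omega> \<in> cyl n (restrict \<omega> {..n})"
        by (auto simp: cyl_def)
      moreover have "restrict \<omega> {..n} \<in> F" using w by (intro restr) auto
      ultimately show "\<omega> \<in> ?L" by blast
    qed
  qed (auto simp: cyl_def F_def PiE_iff)
  finally show ?thesis .
qed

lemma measure_srw_0:
  assumes "v \<in> W"
  shows "measure (srw E x) {\<omega>. (\<forall>i\<le>0. \<omega> i \<in> W) \<and> \<omega> 0 = v} = indicator {x} v"
proof -
  have "{\<omega>. (\<forall>i\<le>0::nat. \<omega> i \<in> W) \<and> \<omega> 0 = v} = {\<omega>. \<forall>i\<le>0. \<omega> i = v}"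
    using assms by auto
  then show ?thesis
    using emeasure_srw_cylinder[of E x 0 "\<lambda>_. v"]
    by (simp only: measure_def lessThan_0 prod.empty) (simp add: indicator_def)
qed

lemma srw_stay_split:
  assumes "finite W"
  shows "measure (srw E x) {\<omega>. \<forall>i\<le>n. \<omega> i \<in> W}
    = (\<Sum>v\<in>W. measure (srw E x) {\<omega>. (\<forall>i\<le>n. \<omega> i \<in> W) \<and> \<omega> n = v})"
proof -
  interpret prob_space "srw E x" by (rule prob_space_srw)
  have "{\<omega>. \<forall>i\<le>n. \<omega> i \<in> W} = (\<Union>v\<in>W. {\<omega>. (\<forall>i\<le>n. \<omega> i \<in> W) \<and> \<omega> n = v})"
    by auto
  then show ?thesis
    using finite_measure_finite_Union[OF assms, of "\<lambda>v. {\<omega>. (\<forall>i\<le>n. \<omega> i \<in> W) \<and> \<omega> n = v}"]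
      sets_srw_Ball[of n W "\<lambda>a. a = _" n E x]
    by (auto simp: disjoint_family_on_def)
qed

text \<open>Summing over the position at time \<open>n\<close> gives the forward equation of the
  walk killed on leaving \<open>W\<close>.\<close>

lemma srw_stay_step:
  assumes "finite W" and "u \<in> W"
  shows "measure (srw E x) {\<omega>. (\<forall>i\<le>Suc n. \<omega> i \<in> W) \<and> \<omega> (Suc n) = u}
    = (\<Sum>v\<in>W. measure (srw E x) {\<omega>. (\<forall>i\<le>n. \<omega> i \<in> W) \<and> \<omega> n = v} * pmf (srw_step E v) u)"
proof -
  interpret prob_space "srw E x" by (rule prob_space_srw)
  let ?A = "\<lambda>v. {\<omega>. (\<forall>i\<le>n. \<omega> i \<in> W) \<and> \<omega> n = v \<and> \<omega> (Suc n) = u}"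
  have "?A v = {\<omega>. (\<forall>i\<le>n. \<omega> i \<in> W) \<and> \<omega> n = v} \<inter> {\<omega>. (\<forall>i\<le>n. \<omega> i \<in> W) \<and> \<omega> (Suc n) = u}" for v
    by blast
  then have A: "?A v \<in> events" for v
    using sets_srw_Ball[of n W "\<lambda>a. a = v" n E x] sets_srw_Ball[of n W "\<lambda>a. a = u" "Suc n" E x]
    by simp
  have "{\<omega>. (\<forall>i\<le>Suc n. \<omega> i \<in> W) \<and> \<omega> (Suc n) = u} = (\<Union>v\<in>W. ?A v)"
    using assms(2) by (auto simp: le_Suc_eq)
  then have "measure (srw E x) {\<omega>. (\<forall>i\<le>Suc n. \<omega> i \<in> W) \<and> \<omega> (Suc n) = u}
     = (\<Sum>v\<in>W. prob (?A v))"
    using finite_measure_finite_Union[OF assms(1), of ?A] A by (auto simp: disjoint_family_on_def)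
  then show ?thesis by (simp add: srw_markov[OF assms(1)])
qed

text \<open>Trajectories range over the whole type, so staying in \<open>V\<close> holds only almost
  surely. This later identifies not having hit \<open>y\<close> with staying in
  \<open>V - {y}\<close>.\<close>

lemma srw_stay_1:
  assumes "finite V" and "x \<in> V" and "\<And>v. v \<in> V \<Longrightarrow> set_pmf (srw_step E v) \<subseteq> V"
  shows "measure (srw E x) {\<omega>. \<forall>i\<le>n. \<omega> i \<in> V} = 1"
proof (induction n)
  case 0
  have "measure (srw E x) {\<omega>. \<forall>i\<le>0. \<omega> i \<in> V} = (\<Sum>v\<in>V. indicator {x} v)"
    unfolding srw_stay_split[OF assms(1)] by (rule sum.cong[OF refl measure_srw_0])
  then show ?case using assms by (simp add: indicator_def)
next
  case (Suc n)
  have "measure (srw E x) {\<omega>. \<forall>i\<le>Suc n. \<omega> i \<in> V}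
     = (\<Sum>u\<in>V. \<Sum>v\<in>V. measure (srw E x) {\<omega>. (\<forall>i\<le>n. \<omega> i \<in> V) \<and> \<omega> n = v} * pmf (srw_step E v) u)"
    unfolding srw_stay_split[OF assms(1), of E x "Suc n"] by (simp add: srw_stay_step assms(1))
  also have "\<dots> = (\<Sum>v\<in>V. measure (srw E x) {\<omega>. (\<forall>i\<le>n. \<omega> i \<in> V) \<and> \<omega> n = v} *
      (\<Sum>u\<in>V. pmf (srw_step E v) u))"
    by (subst sum.swap) (simp add: sum_distrib_left)
  also have "\<dots> = (\<Sum>v\<in>V. measure (srw E x) {\<omega>. (\<forall>i\<le>n. \<omega> i \<in> V) \<and> \<omega> n = v})"
    by (simp add: sum_pmf_eq_1 assms)
  finally show ?case using Suc srw_stay_split[OF assms(1), of E x n] by simp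
qed

text \<open>Turns the tail events in the tail-sum formula for the expectation into conditions on
  finitely many positions.\<close>

lemma less_first_hit_iff: "enat n < first_hit y \<omega> \<longleftrightarrow> (\<forall>i\<le>n. \<omega> i \<noteq> y)"
proof
  assume "enat n < first_hit y \<omega>"
  then show "\<forall>i\<le>n. \<omega> i \<noteq> y"
    unfolding first_hit_def by (auto dest: less_INF_D)
next
  assume *: "\<forall>i\<le>n. \<omega> i \<noteq> y"
  have "enat (Suc n) \<le> first_hit y \<omega>"
    unfolding first_hit_def using * not_less_eq_eq by (intro INF_greatest) auto
  then show "enat n < first_hit y \<omega>"
    by (meson enat_ord_simps(2) lessI less_le_trans)
qed

text \<open>With \<open>S n\<close> the expectation of \<open>h\<close> at time \<open>n\<close> on the event that \<open>y\<close> has not been hit, and \<open>r n\<close> the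
  probability of that event, the equation for \<open>h\<close> gives \<open>S (n + 1) = S n - r n\<close>. Hence \<open>r\<close> is summable,
  so \<open>S\<close>, which is at most a multiple of \<open>r\<close>, tends to 0.\<close>

lemma hitting_time_eqI:
  fixes h :: "'a \<Rightarrow> real"
  assumes fin: "finite V" and x: "x \<in> V"
    and closed: "\<And>v. v \<in> V \<Longrightarrow> set_pmf (srw_step E v) \<subseteq> V"
    and h_y: "h y = 0" and h_nonneg: "\<And>v. v \<in> V \<Longrightarrow> 0 \<le> h v"
    and h_step: "\<And>v. v \<in> V \<Longrightarrow> v \<noteq> y \<Longrightarrow> h v = 1 + (\<Sum>u\<in>V. pmf (srw_step E v) u * h u)"
  shows "hitting_time E x y = ereal (h x)"
proof -
  interpret prob_space "srw E x" by (rule prob_space_srw)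
  define W where "W = V - {y}"
  have W: "finite W" using fin by (simp add: W_def)
  define a where "a n v = prob {\<omega>. (\<forall>i\<le>n. \<omega> i \<in> W) \<and> \<omega> n = v}" for n v
  define r where "r n = prob {\<omega>. \<forall>i\<le>n. \<omega> i \<in> W}" for n
  define S where "S n = (\<Sum>v\<in>W. a n v * h v)" for n
  have r: "r n = (\<Sum>v\<in>W. a n v)" for n
    unfolding r_def a_def by (rule srw_stay_split[OF W])
  have a_nonneg: "0 \<le> a n v" for n v by (simp add: a_def)
  have S_nonneg: "0 \<le> S n" for n
    unfolding S_def by (intro sum_nonneg mult_nonneg_nonneg a_nonneg h_nonneg) (simp add: W_def)
  \<comment> \<open>Omitting \<open>y\<close> costs nothing because \<open>h y = 0\<close>.\<close>
  have sum_W: "(\<Sum>u\<in>W. pmf (srw_step E v) u * h u) = (\<Sum>u\<in>V. pmf (srw_step E v) u * h u)" for v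
    unfolding W_def using fin h_y by (intro sum.mono_neutral_left) auto
  have S_Suc: "S (Suc n) = S n - r n" for n
  proof -
    have "S (Suc n) = (\<Sum>u\<in>W. \<Sum>v\<in>W. a n v * pmf (srw_step E v) u * h u)"
      unfolding S_def by (intro sum.cong refl) (simp add: a_def srw_stay_step[OF W] sum_distrib_right)
    also have "\<dots> = (\<Sum>v\<in>W. a n v * (\<Sum>u\<in>W. pmf (srw_step E v) u * h u))"
      by (subst sum.swap) (simp add: sum_distrib_left mult_ac)
    also have "\<dots> = (\<Sum>v\<in>W. a n v * (h v - 1))"
      by (intro sum.cong refl) (use h_step in \<open>auto simp: sum_W, auto simp: W_def\<close>)
    finally show ?thesis by (simp add: S_def r sum_subtractf right_diff_distrib)
  qed
  have S_0: "S 0 = h x"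
  proof -
    have "S 0 = (\<Sum>v\<in>W. indicator {x} v * h v)"
      unfolding S_def a_def by (intro sum.cong refl) (simp only: measure_srw_0)
    also have "\<dots> = h x"
      \<comment> \<open>If \<open>x = y\<close>, the walk is killed at once and both sides are
        0.\<close>
      using x h_y W by (cases "x = y") (auto simp: W_def indicator_def)
    finally show ?thesis .
  qed
  have partial: "(\<Sum>k<n. r k) = h x - S n" for n
    by (induction n) (auto simp: S_0 S_Suc)
  have r_nonneg: "0 \<le> r n" for n by (simp add: r_def)
  have summ: "summable r"
    by (rule summableI_nonneg_bounded[of _ "h x"]) (use r_nonneg S_nonneg partial in auto)
  define B where "B = (\<Sum>v\<in>W. h v)"
  have S_le: "S n \<le> B * r n" for n
  proof -
    have "h v \<le> B" if "v \<in> W" for v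
      unfolding B_def using that W h_nonneg by (intro member_le_sum) (auto simp: W_def)
    then have "S n \<le> (\<Sum>v\<in>W. a n v * B)"
      unfolding S_def by (intro sum_mono mult_left_mono a_nonneg) auto
    then show ?thesis by (simp add: r sum_distrib_left mult.commute)
  qed
  have "(\<lambda>n. B * r n) \<longlonglongrightarrow> 0"
    using tendsto_mult_right_zero[OF summable_LIMSEQ_zero[OF summ]] .
  then have "S \<longlonglongrightarrow> 0"
    using S_nonneg S_le by (intro real_tendsto_sandwich[of "\<lambda>_. 0" S _ "\<lambda>n. B * r n"]) auto
  then have "(\<lambda>n. h x - S n) \<longlonglongrightarrow> h x - 0"
    by (intro tendsto_intros)
  then have sums: "r sums h x" by (simp add: sums_def partial)
  have tail: "emeasure (srw E x) {\<omega> \<in> space (srw E x). enat n < first_hit y \<omega>} = ennreal (r n)" for n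
  proof -
    have AE_V: "AE \<omega> in srw E x. \<forall>i\<le>n. \<omega> i \<in> V"
      using prob_eq_1[of "{\<omega>. \<forall>i\<le>n. \<omega> i \<in> V}"] srw_stay_1[OF fin x closed, of n]
        sets_srw_Ball[of n V "\<lambda>_. True" 0 E x]
      by simp
    have "prob {\<omega>. \<forall>i\<le>n. \<omega> i \<noteq> y} = r n"
      unfolding r_def
    proof (rule finite_measure_eq_AE)
      show "AE \<omega> in srw E x. (\<omega> \<in> {\<omega>. \<forall>i\<le>n. \<omega> i \<noteq> y}) = (\<omega> \<in> {\<omega>. \<forall>i\<le>n. \<omega> i \<in> W})"
        using AE_V by eventually_elim (auto simp: W_def)
      show "{\<omega>. \<forall>i\<le>n. \<omega> i \<noteq> y} \<in> events"
        using sets_srw_Ball[of n "- {y}" "\<lambda>_. True" 0 E x] by simp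
      show "{\<omega>. \<forall>i\<le>n. \<omega> i \<in> W} \<in> events"
        using sets_srw_Ball[of n W "\<lambda>_. True" 0 E x] by simp
    qed
    then show ?thesis
      by (simp add: space_srw less_first_hit_iff emeasure_eq_measure)
  qed
  have "(\<integral>\<^sup>+ \<omega>. ennreal_of_enat (first_hit y \<omega>) \<partial>srw E x)
      = (\<Sum>n. emeasure (srw E x) {\<omega> \<in> space (srw E x). enat n < first_hit y \<omega>})"
    by (rule nn_integral_enat_function) (rule first_hit_measurable)
  also have "\<dots> = ennreal (h x)"
    unfolding tail using sums r_nonneg by (simp add: suminf_ennreal2 sums_iff)
  finally show ?thesis
    unfolding hitting_time_def using h_nonneg[OF x] by simp
qed

subsection \<open>Paths and distances in a tree\<close>

lemma graph_walk_append:
  assumes "graph_walk V E u p v" and "graph_walk V E v q w"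
  shows "graph_walk V E u (p @ tl q) w"
proof (cases "tl q = []")
  case True
  with assms show ?thesis by (cases q) (auto simp: graph_walk_def)
next
  case False
  with assms show ?thesis
    by (cases q) (auto simp: graph_walk_def successively_append_iff successively_Cons)
qed

lemma graph_walk_Cons:
  assumes "graph_walk V E a p v" and "u \<in> V" and "{u, a} \<in> E"
  shows "graph_walk V E u (u # p) v"
  using assms by (auto simp: graph_walk_def successively_Cons)

lemma graph_walk_rev:
  assumes "graph_walk V E u p v"
  shows "graph_walk V E v (rev p) u"
  using assms by (auto simp: graph_walk_def hd_rev last_rev insert_commute)

lemma graph_walk_split:
  assumes "graph_walk V E u (p @ z # q) v"
  shows "graph_walk V E u (p @ [z]) z" and "graph_walk V E z (z # q) v"
proof -
  show "graph_walk V E u (p @ [z]) z"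
    using assms by (auto simp: graph_walk_def successively_append_iff hd_append)
  show "graph_walk V E z (z # q) v"
    using assms by (auto simp: graph_walk_def successively_append_iff)
qed

lemma graph_dist_le:
  assumes "graph_walk V E u p v"
  shows "graph_dist V E u v \<le> length p - 1"
  unfolding graph_dist_def
  by (rule Least_le) (use assms in \<open>auto simp: graph_walk_def intro!: exI[of _ p]\<close>)

text \<open>Cutting out the closed part between two visits to one vertex would give a walk shorter
  than the distance.\<close>

lemma shortest_walk_is_path:
  assumes "graph_walk V E u p v" and "length p \<le> Suc (graph_dist V E u v)"
  shows "graph_path V E u p v"
proof (rule ccontr)
  assume "\<not> graph_path V E u p v"
  with assms(1) have "\<not> distinct p" by (simp add: graph_path_def)
  then obtain xs ys zs z where p: "p = xs @ [z] @ ys @ [z] @ zs"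
    using not_distinct_decomp by blast
  have "graph_walk V E u (xs @ [z]) z"
    using assms(1) graph_walk_split(1)[of V E u xs z "ys @ [z] @ zs" v] by (simp add: p)
  moreover have "graph_walk V E z (z # zs) v"
    using assms(1) graph_walk_split(2)[of V E u "xs @ [z] @ ys" z zs v] by (simp add: p)
  ultimately have "graph_walk V E u ((xs @ [z]) @ tl (z # zs)) v"
    by (rule graph_walk_append)
  from graph_dist_le[OF this] assms(2) show False by (simp add: p)
qed

text \<open>Stated for arbitrary \<open>V\<close> and \<open>E\<close>, since
  \<open>path_unique\<close> applies it after removing a vertex.\<close>

lemma shortest_path_exists:
  assumes "graph_walk V E u p v"
  obtains q where "graph_path V E u q v" and "length q = Suc (graph_dist V E u v)"
proof -
  have "\<exists>n q. graph_walk V E u q v \<and> length q = Suc n"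
    using assms by (intro exI[of _ "length p - 1"] exI[of _ p]) (auto simp: graph_walk_def)
  then have "\<exists>q. graph_walk V E u q v \<and> length q = Suc (graph_dist V E u v)"
    unfolding graph_dist_def by (rule LeastI_ex)
  then show thesis using that shortest_walk_is_path by fastforce
qed

lemma graph_path_ConsD:
  assumes "graph_path V E u (w # p) v" and "p \<noteq> []"
  shows "w = u" and "{u, hd p} \<in> E" and "u \<notin> set p" and "u \<in> V"
    and "graph_path (V - {u}) E (hd p) p v" and "graph_path V E (hd p) p v"
  using assms by (auto simp: graph_path_def graph_walk_def successively_Cons)

locale tree_graph =
  fixes V :: "'a set" and E :: "'a set set"
  assumes tree: "finite_tree V E"
begin

abbreviation d :: "'a \<Rightarrow> 'a \<Rightarrow> nat" where "d \<equiv> graph_dist V E"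

lemma finite_V: "finite V"
  and edge_subset: "e \<in> E \<Longrightarrow> e \<subseteq> V"
  and edge_card: "e \<in> E \<Longrightarrow> card e = 2"
  and no_cycle: "\<not> graph_cycle V E p"
  using tree by (auto simp: finite_tree_def simple_graph_def)

lemma finite_E: "finite E"
  by (rule finite_subset[of _ "Pow V"]) (use edge_subset finite_V in auto)

lemma edgeD: "{a, b} \<in> E \<Longrightarrow> a \<in> V \<and> b \<in> V \<and> a \<noteq> b"
  using edge_subset[of "{a, b}"] edge_card[of "{a, b}"] by (auto simp: card_insert_if split: if_splits)

lemma edgeE:
  assumes "e \<in> E"
  obtains a b where "e = {a, b}" and "a \<noteq> b"
  using edge_card[OF assms] by (auto simp: card_2_iff)

lemma walk_exists:
  assumes "u \<in> V" and "v \<in> V"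
  obtains p where "graph_walk V E u p v"
  using tree assms unfolding finite_tree_def graph_connected_def by blast

text \<open>If two paths left \<open>u\<close> through different neighbours, their remainders,
  joined at \<open>v\<close>, would connect these neighbours while avoiding \<open>u\<close>;
  shortened to a path, this closes through \<open>u\<close> to a cycle. So the second vertices agree
  and induction applies.\<close>

lemma path_unique:
  assumes "graph_path V E u p v" and "graph_path V E u q v"
  shows "p = q"
  using assms
proof (induction p arbitrary: u q)
  case Nil
  then show ?case by (simp add: graph_path_def graph_walk_def)
next
  case (Cons w p)
  from Cons.prems obtain w' q' where q: "q = w' # q'"
    by (cases q) (auto simp: graph_path_def graph_walk_def)
  have w: "w = u" "w' = u" using Cons.prems by (auto simp: q graph_path_def graph_walk_def)
  show ?case
  proof (cases "p = [] \<or> q' = []")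
    \<comment> \<open>One path is a single vertex, so \<open>u = v\<close>, and a longer path would
      repeat this vertex at its end.\<close>
    case True
    then show ?thesis
      using Cons.prems last_in_set[of p] last_in_set[of q']
      by (auto simp: q w graph_path_def graph_walk_def split: if_splits)
  next
    case False
    note p1 = graph_path_ConsD[OF Cons.prems(1)] and q1 = graph_path_ConsD[OF Cons.prems(2)[unfolded q]]
    have "hd p = hd q'"
    proof (rule ccontr)
      assume ne: "hd p \<noteq> hd q'"
      have "graph_walk (V - {u}) E (hd p) (p @ tl (rev q')) (hd q')"
        using p1(5) q1(5) False
        by (intro graph_walk_append[OF _ graph_walk_rev, of _ _ _ _ v]) (auto simp: graph_path_def)
      then obtain r where r: "graph_path (V - {u}) E (hd p) r (hd q')"
        by (rule shortest_path_exists)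
      then have r': "r \<noteq> []" "hd r = hd p" "last r = hd q'" "set r \<subseteq> V - {u}" "distinct r"
        "successively (\<lambda>a b. {a, b} \<in> E) r"
        by (auto simp: graph_path_def graph_walk_def)
      \<comment> \<open>Together with \<open>u\<close> this gives the three vertices that a cycle
        requires.\<close>
      then have "2 \<le> length r"
        using ne by (cases r; cases "tl r") auto
      then have "graph_cycle V E (u # r)"
        using r' p1(2,4) q1(2) False
        by (auto simp: graph_cycle_def graph_path_def graph_walk_def successively_Cons insert_commute)
      with no_cycle show False by blast
    qed
    then have "p = q'"
      using Cons.IH[of "hd p" q'] p1(6) q1(6) False by simp
    then show ?thesis by (simp add: q w)
  qed
qed

lemma tree_path_eqI: "graph_path V E u p v \<Longrightarrow> tree_path V E u v = p"
  unfolding tree_path_def by (rule the_equality) (auto intro: path_unique)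

text \<open>Some path is shortest, and by uniqueness it is the only one.\<close>

lemma tree_path:
  assumes "u \<in> V" and "v \<in> V"
  shows "graph_path V E u (tree_path V E u v) v" and "length (tree_path V E u v) = Suc (d u v)"
proof -
  obtain p where "graph_walk V E u p v" using walk_exists assms by blast
  then obtain q where "graph_path V E u q v" and "length q = Suc (d u v)"
    by (rule shortest_path_exists)
  then show "graph_path V E u (tree_path V E u v) v" and "length (tree_path V E u v) = Suc (d u v)"
    using tree_path_eqI by auto
qed

lemma tree_walk: "u \<in> V \<Longrightarrow> v \<in> V \<Longrightarrow> graph_walk V E u (tree_path V E u v) v"
  using tree_path(1) by (simp add: graph_path_def)

lemma path_length:
  assumes "graph_path V E u p v"
  shows "length p = Suc (d u v)"
proof -
  have "u \<in> V" and "v \<in> V"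
    using assms hd_in_set[of p] last_in_set[of p] by (auto simp: graph_path_def graph_walk_def)
  then show ?thesis using tree_path(2)[of u v] tree_path_eqI[OF assms] by simp
qed

lemma d_self: "v \<in> V \<Longrightarrow> d v v = 0"
  using graph_dist_le[of V E v "[v]" v] by (simp add: graph_walk_def)

lemma d_eq_0:
  assumes "u \<in> V" and "v \<in> V" and "d u v = 0"
  shows "u = v"
  using tree_walk[of u v] tree_path(2)[of u v] assms
  by (auto simp: graph_walk_def length_Suc_conv)

lemma d_sym: "u \<in> V \<Longrightarrow> v \<in> V \<Longrightarrow> d u v = d v u"
  using graph_dist_le[OF graph_walk_rev[OF tree_walk, of u v]]
    graph_dist_le[OF graph_walk_rev[OF tree_walk, of v u]] tree_path(2)[of u v] tree_path(2)[of v u]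
  by simp

lemma d_triangle: "u \<in> V \<Longrightarrow> v \<in> V \<Longrightarrow> w \<in> V \<Longrightarrow> d u w \<le> d u v + d v w"
  using graph_dist_le[OF graph_walk_append[OF tree_walk tree_walk], of u v w]
    tree_path(2)[of u v] tree_path(2)[of v w]
  by simp

text \<open>Makes betweenness a metric condition. Splitting the path at \<open>z\<close> bounds both
  distances; conversely, concatenating the paths through \<open>z\<close> gives a walk of minimal
  length, hence the path itself.\<close>

lemma on_tree_path_iff:
  assumes "u \<in> V" and "v \<in> V" and "z \<in> V"
  shows "z \<in> set (tree_path V E u v) \<longleftrightarrow> d u z + d z v = d u v"
proof
  assume "z \<in> set (tree_path V E u v)"
  then obtain p q where pq: "tree_path V E u v = p @ z # q" by (meson split_list)
  then have "graph_walk V E u (p @ z # q) v" using tree_walk assms by metis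
  from graph_walk_split[OF this] have "d u z \<le> length p" "d z v \<le> length q"
    using graph_dist_le by fastforce+
  moreover have "length p + length q = d u v"
    using tree_path(2)[OF assms(1,2)] pq by simp
  ultimately show "d u z + d z v = d u v" using d_triangle[of u z v] assms by simp
next
  let ?p = "tree_path V E u z @ tl (tree_path V E z v)"
  assume "d u z + d z v = d u v"
  then have "graph_path V E u ?p v"
    using assms tree_path(2)
    by (intro shortest_walk_is_path graph_walk_append[OF tree_walk tree_walk]) auto
  then have "tree_path V E u v = ?p" by (rule tree_path_eqI)
  moreover have "z \<in> set (tree_path V E u z)"
    using tree_walk[of u z] assms last_in_set by (fastforce simp: graph_walk_def)
  ultimately show "z \<in> set (tree_path V E u v)" by simp
qed

text \<open>If \<open>a\<close> lay on the path from \<open>b\<close> to \<open>w\<close>, then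
  \<open>d b w\<close> would exceed \<open>d a w\<close>. The weak inequality lets
  \<open>closer_d\<close> also exclude adjacent vertices equidistant from \<open>w\<close>.\<close>

lemma closer_path:
  assumes e: "{a, b} \<in> E" and w: "w \<in> V" and le: "d b w \<le> d a w"
  shows "graph_path V E a (a # tree_path V E b w) w"
proof -
  have V: "a \<in> V" "b \<in> V" "a \<noteq> b" using edgeD[OF e] by auto
  have "a \<notin> set (tree_path V E b w)"
    using on_tree_path_iff[of b w a] d_eq_0[of b a] V w le by auto
  then show ?thesis
    using tree_path(1)[of b w] V w graph_walk_Cons[OF _ V(1) e] by (auto simp: graph_path_def)
qed

lemma closer_d: "{a, b} \<in> E \<Longrightarrow> w \<in> V \<Longrightarrow> d b w \<le> d a w \<Longrightarrow> d a w = Suc (d b w)"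
  using path_length[OF closer_path[of a b w]] tree_path(2)[of b w] edgeD[of a b] by simp

lemma edge_d_cases:
  assumes "{a, b} \<in> E" and "w \<in> V"
  shows "d a w = Suc (d b w) \<or> d b w = Suc (d a w)"
  using closer_d[of a b w] closer_d[of b a w] assms linear[of "d a w" "d b w"]
  by (auto simp: insert_commute)

text \<open>The closer neighbour is the second vertex of the path to \<open>w\<close>. Prepending
  \<open>v\<close> to the path from any closer neighbour yields the path from \<open>v\<close>,
  whence uniqueness.\<close>

lemma ex1_closer:
  assumes "v \<in> V" and "w \<in> V" and "v \<noteq> w"
  shows "\<exists>!u. {v, u} \<in> E \<and> d u w < d v w"
proof (rule ex_ex1I)
  obtain p where p: "tree_path V E v w = v # p"
    using tree_walk[of v w] assms by (cases "tree_path V E v w") (auto simp: graph_walk_def)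
  have "p \<noteq> []"
    using tree_walk[of v w] assms p by (auto simp: graph_walk_def)
  have "graph_path V E v (v # p) w" using tree_path(1) assms p by metis
  note * = graph_path_ConsD[OF this \<open>p \<noteq> []\<close>]
  have "d (hd p) w < d v w"
    using path_length[OF *(6)] tree_path(2)[of v w] assms p by simp
  with * show "\<exists>u. {v, u} \<in> E \<and> d u w < d v w" by blast
next
  fix u u'
  assume u: "{v, u} \<in> E \<and> d u w < d v w" and u': "{v, u'} \<in> E \<and> d u' w < d v w"
  have "tree_path V E u w = tree_path V E u' w"
    using path_unique[OF closer_path[of v u w] closer_path[of v u' w]] u u' assms by simp
  then show "u = u'"
    using tree_walk[of u w] tree_walk[of u' w] edgeD u u' assms by (auto simp: graph_walk_def)
qed

subsection \<open>Solving the hitting time equations\<close>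

definition deg :: "'a \<Rightarrow> nat" where "deg v = card (neighbours E v)"

lemma neighbours_subset: "neighbours E v \<subseteq> V"
  using edgeD by (auto simp: neighbours_def)

lemma finite_neighbours: "finite (neighbours E v)"
  using finite_subset[OF neighbours_subset finite_V] .

lemma neighbours_nonempty: "v \<in> V \<Longrightarrow> w \<in> V \<Longrightarrow> v \<noteq> w \<Longrightarrow> neighbours E v \<noteq> {}"
  using ex1_closer[of v w] by (auto simp: neighbours_def)

lemma deg_eq: "deg v = card {e \<in> E. v \<in> e}"
  unfolding deg_def
proof (rule bij_betw_same_card[of "\<lambda>u. {v, u}"], rule bij_betw_imageI)
  show "inj_on (\<lambda>u. {v, u}) (neighbours E v)"
    by (auto simp: inj_on_def doubleton_eq_iff)
  show "(\<lambda>u. {v, u}) ` neighbours E v = {e \<in> E. v \<in> e}"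
  proof
    show "{e \<in> E. v \<in> e} \<subseteq> (\<lambda>u. {v, u}) ` neighbours E v"
    proof
      fix e assume e: "e \<in> {e \<in> E. v \<in> e}"
      then obtain a b where "e = {a, b}" using edgeE by blast
      with e show "e \<in> (\<lambda>u. {v, u}) ` neighbours E v"
        by (auto simp: neighbours_def insert_commute)
    qed
  qed (auto simp: neighbours_def)
qed

text \<open>Double counting of the incidences between vertices and edges.\<close>

lemma sum_deg:
  fixes f :: "'a \<Rightarrow> real"
  shows "(\<Sum>w\<in>V. real (deg w) * f w) = (\<Sum>e\<in>E. \<Sum>w\<in>e. f w)"
proof -
  have "(\<Sum>w\<in>V. real (deg w) * f w) = (\<Sum>w\<in>V. \<Sum>e\<in>{e. e \<in> E \<and> w \<in> e}. f w)"
    by (simp add: deg_eq)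
  also have "\<dots> = (\<Sum>e\<in>E. \<Sum>w\<in>{w. w \<in> V \<and> w \<in> e}. f w)"
    by (rule sum.swap_restrict[OF finite_V finite_E])
  also have "\<dots> = (\<Sum>e\<in>E. \<Sum>w\<in>e. f w)"
    using edge_subset by (intro sum.cong refl) auto
  finally show ?thesis .
qed

text \<open>Distances to \<open>w\<close> change by exactly one along an edge, so only the number of
  closer neighbours matters: none if \<open>v = w\<close>, one otherwise.\<close>

lemma laplacian_d:
  assumes "v \<in> V" and "w \<in> V"
  shows "(\<Sum>u\<in>neighbours E v. real (d u w))
    = real (deg v) * real (d v w) + real (deg v) - (if v = w then 0 else 2)"
proof -
  let ?N = "neighbours E v"
  let ?C = "{u \<in> ?N. d u w < d v w}"
  have "real (d u w) = real (d v w) + 1 - 2 * (if d u w < d v w then 1 else 0)" if "u \<in> ?N" for u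
    using edge_d_cases[of v u w] that assms by (auto simp: neighbours_def)
  then have "(\<Sum>u\<in>?N. real (d u w))
      = (\<Sum>u\<in>?N. real (d v w) + 1 - 2 * (if d u w < d v w then 1 else 0))"
    by (intro sum.cong) auto
  also have "\<dots> = real (deg v) * (real (d v w) + 1) - 2 * real (card ?C)"
    by (simp add: sum_subtractf deg_def sum_distrib_left[symmetric] sum.If_cases finite_neighbours Int_def)
  also have "card ?C = (if v = w then 0 else 1)"
  proof (cases "v = w")
    case True
    then show ?thesis using d_self[OF assms(2)] by simp
  next
    case False
    then show ?thesis
      using ex1_closer[OF assms False] by (auto simp: neighbours_def card_1_singleton_iff)
  qed
  finally show ?thesis by (cases "v = w") (simp_all add: algebra_simps)
qed

text \<open>In a tree this is the number of edges shared by the paths from \<open>v\<close> and from \<open>w\<close> to \<open>y\<close>.\<close>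

definition overlap :: "'a \<Rightarrow> 'a \<Rightarrow> 'a \<Rightarrow> real" where
  "overlap y v w = (real (d v y) + real (d w y) - real (d v w)) / 2"

text \<open>The expected number of visits to \<open>w\<close> before hitting \<open>y\<close> from \<open>v\<close> is \<open>deg w\<close> times the overlap.\<close>

definition hit :: "'a \<Rightarrow> 'a \<Rightarrow> real" where
  "hit y v = (\<Sum>w\<in>V. real (deg w) * overlap y v w)"

lemma overlap_bounds:
  assumes "v \<in> V" and "w \<in> V" and "y \<in> V"
  shows "0 \<le> overlap y v w" and "overlap y v w \<le> real (d v y)"
  using d_triangle[of v y w] d_triangle[of w v y] d_sym[of y w] d_sym[of w v] assms
  by (auto simp: overlap_def)

lemma srw_step_closed: "v \<in> V \<Longrightarrow> set_pmf (srw_step E v) \<subseteq> V"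
  using neighbours_subset by (auto simp: srw_step_def finite_neighbours)

lemma hit_step:
  assumes v: "v \<in> V" and y: "y \<in> V" and ne: "v \<noteq> y"
  shows "hit y v = 1 + (\<Sum>u\<in>V. pmf (srw_step E v) u * hit y u)"
proof -
  let ?N = "neighbours E v"
  \<comment> \<open>A neighbour exists, so \<open>srw_step\<close> takes its uniform branch.\<close>
  have N: "?N \<noteq> {}" using neighbours_nonempty v y ne by blast
  then have deg_pos: "real (deg v) > 0" by (simp add: deg_def card_gt_0_iff finite_neighbours)
  have avg: "(\<Sum>u\<in>V. pmf (srw_step E v) u * hit y u) = (\<Sum>u\<in>?N. hit y u) / real (deg v)"
  proof -
    have "(\<Sum>u\<in>V. pmf (srw_step E v) u * hit y u) = (\<Sum>u\<in>?N. pmf (srw_step E v) u * hit y u)"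
      using neighbours_subset N finite_neighbours
      by (intro sum.mono_neutral_right finite_V) (auto simp: srw_step_def)
    also have "\<dots> = (\<Sum>u\<in>?N. hit y u / real (deg v))"
      using N finite_neighbours by (intro sum.cong refl) (auto simp: srw_step_def deg_def)
    finally show ?thesis by (simp add: sum_divide_distrib)
  qed
  \<comment> \<open>The Laplacian of the distance to \<open>y\<close> contributes -1, which that of
    the distance to \<open>w\<close> cancels unless \<open>v = w\<close>. Thus the overlap is
    harmonic in \<open>v\<close> away from \<open>w\<close> and \<open>y\<close>.\<close>
  have ov: "(\<Sum>u\<in>?N. overlap y u w) = real (deg v) * overlap y v w - 1 + (if v = w then 0 else 1)"
    if "w \<in> V" for w
    using laplacian_d[OF v y] laplacian_d[OF v that] ne unfolding overlap_def
    by (cases "v = w") (simp_all add: sum_divide_distrib[symmetric] sum.distrib sum_subtractf deg_def[symmetric] field_simps)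
  have "(\<Sum>u\<in>?N. hit y u) = (\<Sum>w\<in>V. real (deg w) * (\<Sum>u\<in>?N. overlap y u w))"
    unfolding hit_def by (subst sum.swap) (simp add: sum_distrib_left)
  \<comment> \<open>Only \<open>w = v\<close> keeps a defect; its weight \<open>deg v\<close>
    becomes the time step 1 after averaging.\<close>
  also have "\<dots> = (\<Sum>w\<in>V. real (deg v) * (real (deg w) * overlap y v w)
      - (if v = w then real (deg w) else 0))"
    by (intro sum.cong refl) (simp add: ov algebra_simps)
  also have "\<dots> = real (deg v) * hit y v - real (deg v)"
    using v finite_V by (simp add: hit_def sum_subtractf sum_distrib_left)
  finally show ?thesis unfolding avg using deg_pos by (simp add: field_simps)
qed

lemma hitting_time_eq_hit:
  assumes "x \<in> V" and "y \<in> V"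
  shows "hitting_time E x y = ereal (hit y x)"
proof (rule hitting_time_eqI[OF finite_V assms(1) srw_step_closed])
  show "hit y y = 0"
    using d_self d_sym assms(2) by (auto simp: hit_def overlap_def intro!: sum.neutral)
  show "0 \<le> hit y v" if "v \<in> V" for v
    unfolding hit_def using overlap_bounds(1) that assms(2) by (intro sum_nonneg mult_nonneg_nonneg) auto
qed (use hit_step assms(2) in auto)

subsection \<open>Edges on and off the path\<close>

text \<open>Cutting the path at position \<open>i\<close> bounds both distances from above; as they
  add up to \<open>d x y\<close>, both bounds are attained.\<close>

lemma tree_path_nth:
  assumes "x \<in> V" and "y \<in> V" and "i \<le> d x y"
  shows "tree_path V E x y ! i \<in> V"
    and "d x (tree_path V E x y ! i) = i"
    and "d (tree_path V E x y ! i) y = d x y - i"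
proof -
  let ?p = "tree_path V E x y"
  have i: "i < length ?p" using tree_path(2)[OF assms(1,2)] assms(3) by simp
  have w: "graph_walk V E x ?p y" using tree_walk assms by blast
  show V: "?p ! i \<in> V" using w i nth_mem by (fastforce simp: graph_walk_def)
  have "graph_walk V E x (take i ?p @ ?p ! i # drop (Suc i) ?p) y"
    using w id_take_nth_drop[OF i] by simp
  from graph_walk_split[OF this, THEN graph_dist_le]
  have "d x (?p ! i) \<le> i" and "d (?p ! i) y \<le> d x y - i"
    using i tree_path(2)[OF assms(1,2)] by auto
  moreover have "d x (?p ! i) + d (?p ! i) y = d x y"
    using on_tree_path_iff[OF assms(1,2) V] i by simp
  ultimately show "d x (?p ! i) = i" and "d (?p ! i) y = d x y - i"
    using assms(3) by auto
qed

lemma overlap_tree_path_nth: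
  assumes "x \<in> V" and "y \<in> V" and "i \<le> d x y"
  shows "overlap y x (tree_path V E x y ! i) = real (d x y) - real i"
  using tree_path_nth[OF assms] assms(3) by (simp add: overlap_def)

definition path_edges :: "'a \<Rightarrow> 'a \<Rightarrow> 'a set set" where
  "path_edges x y = (\<lambda>i. {tree_path V E x y ! i, tree_path V E x y ! Suc i}) ` {..<d x y}"

lemma path_edges_subset:
  assumes "x \<in> V" and "y \<in> V"
  shows "path_edges x y \<subseteq> E"
  using tree_walk[OF assms] tree_path(2)[OF assms]
  by (auto simp: path_edges_def graph_walk_def intro: successively_nth)

lemma tree_path_nth_eq_iff:
  assumes "x \<in> V" and "y \<in> V" and "i \<le> d x y" and "j \<le> d x y"
  shows "tree_path V E x y ! i = tree_path V E x y ! j \<longleftrightarrow> i = j"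
  using tree_path[OF assms(1,2)] assms(3,4) by (simp add: graph_path_def nth_eq_iff_index_eq)

lemma inj_on_path_edges:
  assumes "x \<in> V" and "y \<in> V"
  shows "inj_on (\<lambda>i. {tree_path V E x y ! i, tree_path V E x y ! Suc i}) {..<d x y}"
  using tree_path_nth_eq_iff[OF assms] by (auto simp: inj_on_def doubleton_eq_iff)

lemma card_path_edges: "x \<in> V \<Longrightarrow> y \<in> V \<Longrightarrow> card (path_edges x y) = d x y"
  unfolding path_edges_def by (simp add: card_image inj_on_path_edges)

lemma sum_overlap_path_edges:
  assumes "x \<in> V" and "y \<in> V"
  shows "(\<Sum>e\<in>path_edges x y. \<Sum>w\<in>e. overlap y x w) = (real (d x y))\<^sup>2"
proof -
  let ?p = "tree_path V E x y"
  have "(\<Sum>e\<in>path_edges x y. \<Sum>w\<in>e. overlap y x w)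
      = (\<Sum>i<d x y. \<Sum>w\<in>{?p ! i, ?p ! Suc i}. overlap y x w)"
    unfolding path_edges_def by (simp add: sum.reindex[OF inj_on_path_edges[OF assms]])
  \<comment> \<open>The end points have overlaps \<open>d x y - i\<close> and
    \<open>d x y - i - 1\<close>, so the edges give the odd numbers.\<close>
  also have "\<dots> = (\<Sum>i<d x y. 2 * (real (d x y) - real i) - 1)"
  proof (rule sum.cong)
    fix i assume "i \<in> {..<d x y}"
    then show "(\<Sum>w\<in>{?p ! i, ?p ! Suc i}. overlap y x w) = 2 * (real (d x y) - real i) - 1"
      using overlap_tree_path_nth[OF assms, of i] overlap_tree_path_nth[OF assms, of "Suc i"]
        tree_path_nth_eq_iff[OF assms, of i "Suc i"]
      by simp
  qed simp
  also have "\<dots> = (real (d x y))\<^sup>2"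
  proof -
    \<comment> \<open>The constant \<open>c\<close> is kept apart from the number of terms for the
      induction; both are then the distance.\<close>
    have "(\<Sum>i<n. 2 * (c - real i) - 1) = 2 * c * real n - (real n)\<^sup>2" for c :: real and n
      by (induction n) (auto simp: power2_eq_square algebra_simps)
    then show ?thesis by (simp add: power2_eq_square)
  qed
  finally show ?thesis .
qed

text \<open>The paths from \<open>x\<close> to \<open>a\<close> and from \<open>b\<close> to \<open>y\<close> are disjoint by the triangle inequality, so joining
  them by the edge gives the path from \<open>x\<close> to \<open>y\<close>.\<close>

lemma crossing_edge_on_path:
  assumes x: "x \<in> V" and y: "y \<in> V" and e: "{a, b} \<in> E"
    and a: "d a y = Suc (d b y)" and b: "d x b = Suc (d x a)"
  shows "{a, b} \<in> path_edges x y"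
proof -
  have V: "a \<in> V" "b \<in> V" using edgeD[OF e] by auto
  let ?q = "tree_path V E x a @ tree_path V E b y"
  have "graph_walk V E x ?q y"
    using graph_walk_append[OF tree_walk[OF x V(1)] graph_walk_Cons[OF tree_walk[OF V(2) y] V(1) e]]
    by simp
  moreover have "set (tree_path V E x a) \<inter> set (tree_path V E b y) = {}"
  proof (rule ccontr)
    assume "set (tree_path V E x a) \<inter> set (tree_path V E b y) \<noteq> {}"
    then obtain c where c: "c \<in> set (tree_path V E x a)" "c \<in> set (tree_path V E b y)" by blast
    then have cV: "c \<in> V" using tree_walk[OF x V(1)] by (auto simp: graph_walk_def)
    have "d x c + d c a = d x a" "d b c + d c y = d b y"
      using c on_tree_path_iff x y V cV by auto
    moreover have "d x b \<le> d x c + d c b" "d a y \<le> d a c + d c y"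
      using d_triangle x y V cV by auto
    ultimately show False using a b d_sym[OF V(1) cV] d_sym[OF V(2) cV] by simp
  qed
  ultimately have "graph_path V E x ?q y"
    using tree_path(1)[OF x V(1)] tree_path(1)[OF V(2) y] by (simp add: graph_path_def)
  then have q: "tree_path V E x y = ?q" by (rule tree_path_eqI)
  have len: "length (tree_path V E x a) = Suc (d x a)" "length (tree_path V E b y) = Suc (d b y)"
    using tree_path(2) x y V by auto
  have "Suc (d x y) = Suc (d x a) + Suc (d b y)"
    using tree_path(2)[OF x y] len by (simp add: q)
  moreover have "?q ! d x a = a"
    using tree_walk[OF x V(1)] len(1) last_conv_nth[of "tree_path V E x a"]
    by (simp add: nth_append graph_walk_def)
  moreover have "?q ! Suc (d x a) = b"
    using tree_walk[OF V(2) y] len(1) hd_conv_nth[of "tree_path V E b y"]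
    by (simp add: nth_append graph_walk_def)
  ultimately show ?thesis
    unfolding path_edges_def q by (intro image_eqI[of _ _ "d x a"]) auto
qed

text \<open>Along an edge the distances to \<open>x\<close> and to \<open>y\<close> each change by
  one. Opposite changes force the edge onto the path by \<open>crossing_edge_on_path\<close>; equal
  changes cancel in the overlap.\<close>

lemma overlap_off_path:
  assumes "x \<in> V" and "y \<in> V" and "{a, b} \<in> E" and "{a, b} \<notin> path_edges x y"
  shows "overlap y x a = overlap y x b"
  using crossing_edge_on_path[OF assms(1-3)] crossing_edge_on_path[OF assms(1,2), of b a]
    edge_d_cases[OF assms(3,2)] edge_d_cases[OF assms(3,1)] edgeD[OF assms(3)]
    d_sym[OF assms(1), of a] d_sym[OF assms(1), of b] assms
  by (auto simp: overlap_def insert_commute)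

text \<open>Passes from edges to vertices for the equality cases. A vertex off the path has an edge,
  which cannot be a path edge; an edge off the path has an end off the path, and the overlap agrees
  at both ends.\<close>

lemma overlap_const_off_path_iff:
  assumes x: "x \<in> V" and y: "y \<in> V"
  shows "(\<forall>e\<in>E - path_edges x y. \<forall>w\<in>e. overlap y x w = c)
    \<longleftrightarrow> (\<forall>w\<in>V. w \<in> set (tree_path V E x y) \<or> overlap y x w = c)" (is "?L \<longleftrightarrow> ?R")
proof
  assume L: ?L
  show ?R
  proof (intro ballI)
    fix w assume w: "w \<in> V"
    have "overlap y x w = c" if off: "w \<notin> set (tree_path V E x y)"
    proof -
      from off have "w \<noteq> x"
        using on_tree_path_iff[OF x y x] d_self[OF x] by auto
      then obtain u where u: "{w, u} \<in> E" using ex1_closer[OF w x] by blast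
      have "{w, u} \<notin> path_edges x y"
      proof
        assume "{w, u} \<in> path_edges x y"
        then obtain i where "i < d x y" "w \<in> {tree_path V E x y ! i, tree_path V E x y ! Suc i}"
          unfolding path_edges_def by blast
        with off show False using tree_path(2)[OF x y] nth_mem by fastforce
      qed
      with L u show ?thesis by blast
    qed
    then show "w \<in> set (tree_path V E x y) \<or> overlap y x w = c" by blast
  qed
next
  assume R: ?R
  show ?L
  proof (intro ballI)
    fix e w assume e: "e \<in> E - path_edges x y" and w: "w \<in> e"
    obtain u where u: "e = {w, u}" "w \<noteq> u"
      using edgeE[of e] e w by (metis DiffD1 insertE insert_commute singletonD)
    then have eq: "overlap y x w = overlap y x u"
      using overlap_off_path[OF x y, of w u] e by simp
    have V: "w \<in> V" "u \<in> V" using edgeD e u by auto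
    \<comment> \<open>Equal overlaps at two path vertices force equal positions.\<close>
    have "w \<notin> set (tree_path V E x y) \<or> u \<notin> set (tree_path V E x y)"
    proof (rule ccontr)
      assume "\<not> ?thesis"
      then obtain i j where "i \<le> d x y" "j \<le> d x y"
        "w = tree_path V E x y ! i" "u = tree_path V E x y ! j"
        using tree_path(2)[OF x y] by (auto simp: in_set_conv_nth less_Suc_eq_le)
      then show False
        using eq u(2) overlap_tree_path_nth[OF x y, of i] overlap_tree_path_nth[OF x y, of j] by simp
    qed
    then show "overlap y x w = c" using R V eq by auto
  qed
qed

section \<open>Bounds and equality cases from edge sums\<close>

lemma hit_eq:
  assumes "x \<in> V" and "y \<in> V"
  shows "hit y x = (real (d x y))\<^sup>2 + (\<Sum>e\<in>E - path_edges x y. \<Sum>w\<in>e. overlap y x w)"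
proof -
  have "hit y x = (\<Sum>e\<in>E. \<Sum>w\<in>e. overlap y x w)"
    unfolding hit_def by (rule sum_deg)
  also have "\<dots> = (\<Sum>e\<in>E - path_edges x y. \<Sum>w\<in>e. overlap y x w)
      + (\<Sum>e\<in>path_edges x y. \<Sum>w\<in>e. overlap y x w)"
    by (rule sum.subset_diff[OF path_edges_subset[OF assms] finite_E])
  finally show ?thesis by (simp add: sum_overlap_path_edges[OF assms])
qed

text \<open>Measuring the deficit from the maximal overlap turns the upper bound into non-negativity
  of a sum, just as \<open>hit_eq\<close> does for the lower bound.\<close>

lemma hit_eq_upper:
  assumes "x \<in> V" and "y \<in> V"
  shows "hit y x = real (d x y) * (2 * real (card E) - real (d x y))
    - (\<Sum>e\<in>E - path_edges x y. \<Sum>w\<in>e. real (d x y) - overlap y x w)"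
proof -
  let ?F = "E - path_edges x y"
  have "card ?F = card E - d x y"
    using card_Diff_subset[of "path_edges x y" E] path_edges_subset[OF assms] card_path_edges[OF assms]
      finite_subset finite_E by metis
  \<comment> \<open>Makes the subtraction of natural numbers above exact.\<close>
  moreover have "d x y \<le> card E"
    using card_mono[OF finite_E path_edges_subset[OF assms]] card_path_edges[OF assms] by simp
  moreover have "(\<Sum>e\<in>?F. \<Sum>w\<in>e. real (d x y)) = 2 * real (card ?F) * real (d x y)"
    by (simp add: edge_card)
  ultimately show ?thesis
    unfolding hit_eq[OF assms]
    by (simp add: sum_subtractf power2_eq_square algebra_simps)
qed

text \<open>Serves both the overlap and its deficit, giving each bound together with its equality
  case.\<close>

lemma edge_sum_nonneg:
  fixes f :: "'a \<Rightarrow> real"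
  assumes "F \<subseteq> E" and "\<And>w. w \<in> V \<Longrightarrow> 0 \<le> f w"
  shows "0 \<le> (\<Sum>e\<in>F. \<Sum>w\<in>e. f w)"
    and "(\<Sum>e\<in>F. \<Sum>w\<in>e. f w) = 0 \<longleftrightarrow> (\<forall>e\<in>F. \<forall>w\<in>e. f w = 0)"
proof -
  have f: "0 \<le> f w" if "e \<in> F" "w \<in> e" for e w
    using assms edge_subset that by blast
  have inner: "(\<Sum>w\<in>e. f w) = 0 \<longleftrightarrow> (\<forall>w\<in>e. f w = 0)" if "e \<in> F" for e
  proof (rule sum_nonneg_eq_0_iff)
    show "finite e" using that assms(1) edge_subset finite_subset[OF _ finite_V] by blast
  qed (use f that in blast)
  show "0 \<le> (\<Sum>e\<in>F. \<Sum>w\<in>e. f w)"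
    using f by (intro sum_nonneg) auto
  have "(\<Sum>e\<in>F. \<Sum>w\<in>e. f w) = 0 \<longleftrightarrow> (\<forall>e\<in>F. (\<Sum>w\<in>e. f w) = 0)"
    using f finite_subset[OF assms(1) finite_E] by (intro sum_nonneg_eq_0_iff sum_nonneg) auto
  then show "(\<Sum>e\<in>F. \<Sum>w\<in>e. f w) = 0 \<longleftrightarrow> (\<forall>e\<in>F. \<forall>w\<in>e. f w = 0)"
    using inner by simp
qed

lemma overlap_eq_0_iff:
  assumes "x \<in> V" and "y \<in> V" and "w \<in> V"
  shows "overlap y x w = 0 \<longleftrightarrow> y \<in> set (tree_path V E w x)"
  using on_tree_path_iff[of w x y] d_sym[of w x] d_sym[of x y] assms
  by (auto simp: overlap_def)

lemma overlap_eq_d_iff: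
  assumes "x \<in> V" and "y \<in> V" and "w \<in> V"
  shows "overlap y x w = real (d x y) \<longleftrightarrow> x \<in> set (tree_path V E w y)"
  using on_tree_path_iff[of w y x] d_sym[of w x] assms
  by (auto simp: overlap_def field_simps)

end

theorem theorem11:
  fixes V :: "'a set" and E :: "'a set set" and x y :: 'a
  assumes "finite_tree V E" and "x \<in> V" and "y \<in> V"
  shows "ereal ((real (graph_dist V E x y))\<^sup>2) \<le> hitting_time E x y \<and>
    hitting_time E x y
      \<le> ereal (real (graph_dist V E x y) * (2 * real (card E) - real (graph_dist V E x y))) \<and>
    (hitting_time E x y = ereal ((real (graph_dist V E x y))\<^sup>2) \<longleftrightarrow>
      (\<forall>w\<in>V. w \<in> set (tree_path V E x y) \<or> y \<in> set (tree_path V E w x))) \<and>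
    (hitting_time E x y
        = ereal (real (graph_dist V E x y) * (2 * real (card E) - real (graph_dist V E x y))) \<longleftrightarrow>
      (\<forall>w\<in>V. w \<in> set (tree_path V E x y) \<or> x \<in> set (tree_path V E w y)))"
proof -
  interpret tree_graph V E by (rule tree_graph.intro) (rule assms(1))
  note xy = assms(2,3)
  let ?F = "E - path_edges x y"
  have F: "?F \<subseteq> E" by blast
  have lower: "0 \<le> overlap y x w" if "w \<in> V" for w
    using overlap_bounds(1)[OF xy(1) that xy(2)] .
  have upper: "0 \<le> real (d x y) - overlap y x w" if "w \<in> V" for w
    using overlap_bounds(2)[OF xy(1) that xy(2)] by simp
  have "(\<Sum>e\<in>?F. \<Sum>w\<in>e. overlap y x w) = 0 \<longleftrightarrow> (\<forall>e\<in>?F. \<forall>w\<in>e. overlap y x w = 0)"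
    by (rule edge_sum_nonneg(2)[OF F lower])
  then have lower_iff: "(\<forall>w\<in>V. w \<in> set (tree_path V E x y) \<or> y \<in> set (tree_path V E w x))
      \<longleftrightarrow> (\<Sum>e\<in>?F. \<Sum>w\<in>e. overlap y x w) = 0"
    unfolding overlap_const_off_path_iff[OF xy] using overlap_eq_0_iff[OF xy] by auto
  have "(\<Sum>e\<in>?F. \<Sum>w\<in>e. real (d x y) - overlap y x w) = 0
      \<longleftrightarrow> (\<forall>e\<in>?F. \<forall>w\<in>e. overlap y x w = real (d x y))"
    by (subst edge_sum_nonneg(2)[OF F upper]) auto
  then have upper_iff: "(\<forall>w\<in>V. w \<in> set (tree_path V E x y) \<or> x \<in> set (tree_path V E w y))
      \<longleftrightarrow> (\<Sum>e\<in>?F. \<Sum>w\<in>e. real (d x y) - overlap y x w) = 0"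
    unfolding overlap_const_off_path_iff[OF xy] using overlap_eq_d_iff[OF xy] by auto
  show ?thesis
    unfolding hitting_time_eq_hit[OF xy] lower_iff upper_iff
    using edge_sum_nonneg(1)[where f = "overlap y x", OF F lower]
      edge_sum_nonneg(1)[where f = "\<lambda>w. real (d x y) - overlap y x w", OF F upper] hit_eq[OF xy] hit_eq_upper[OF xy] by auto
qed

end
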